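(* Let $X$ be a compact topological space and $f_{1,\infty}=\{f_i\}_{i=1}^\infty$ a sequence of continuous self-maps of $X$. Then for any $Z\subseteq X$, $\theta\in[0,1]$ and $m\in\mathbb N$, \[ \underline{h}_{\mathrm{top}}(f_{1,\infty}^m,Z,\theta)\le m\,\underline{h}_{\mathrm{top}}(f_{1,\infty},Z,\theta) \quad\text{and}\quad \overline{h}_{\mathrm{top}}(f_{1,\infty}^m,Z,\theta)\le m\,\overline{h}_{\mathrm{top}}(f_{1,\infty},Z,\theta), \] where $f_{1,\infty}^m=\{f_{im+1}^m\}_{i=0}^\infty$, with $f_{im+1}^m=f_{im+m}\circ\cdots\circ f_{im+2}\circ f_{im+1}$.
   Context: Intermediate topological entropies. Let $X$ be a compact topological space and $f_{1,\infty}=\{f_i\}_{i=1}^\infty$ a sequence of continuous maps $X\to X$. Put $f_i^0=\mathrm{id}_X$ and $f_i^j=f_{i+j-1}\circ\cdots\circ f_{i+1}\circ f_i$ for $j\ge1$. For a finite open cover $\mathcal U$ of $X$ and $m\in\mathbb N=\{1,2,\dots\}$, a string of length $m(\mathbf U)=m$ is an element $\mathbf U=(U_0,\dots,U_{m-1})\in\mathcal S_m(\mathcal U):=\mathcal U^m$, and $X(\mathbf U)=\{x\in X: f_1^j(x)\in U_j,\ 0\le j\le m-1\}$. For $Z\subseteq X$, $\alpha\ge0$, $\theta\in[0,1]$, $N\in\mathbb N$ let \[ M(Z,\alpha,\mathcal U,N,\theta)=\inf_{\mathcal G}\sum_{\mathbf U\in\mathcal G}e^{-\alpha m(\mathbf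 U)}, \] the infimum over all finite or countable collections $\mathcal G\subseteq\bigcup_{N\le m<N/\theta+1}\mathcal S_m(\mathcal U)$ with $Z\subseteq\bigcup_{\mathbf U\in\mathcal G}X(\mathbf U)$ (for $\theta=0$, $N/\theta=+\infty$). Let $\underline m(Z,\alpha,\mathcal U,\theta)=\liminf_{N\to\infty}M(Z,\alpha,\mathcal U,N,\theta)$ and $\overline m(Z,\alpha,\mathcal U,\theta)=\limsup_{N\to\infty}M(Z,\alpha,\mathcal U,N,\theta)$. Set $\underline h_{\mathrm{top}}(f_{1,\infty},Z,\mathcal U,\theta)=\inf\{\alpha\ge0:\underline m(Z,\alpha,\mathcal U,\theta)=0\}$, $\overline h_{\mathrm{top}}(f_{1,\infty},Z,\mathcal U,\theta)=\inf\{\alpha\ge0:\overline m(Z,\alpha,\mathcal U,\theta)=0\}$. The lower and upper $\theta$-intermediate topological entropies $\underline h_{\mathrm{top}}(f_{1,\infty},Z,\theta)$ and $\overline h_{\mathrm{top}}(f_{1,\infty},Z,\theta)$, with values in $[0,\infty]$, are the suprema of these quantities over all finite open covers $\mathcal U$ of $X$. The entropies of $f_{1,\infty}^m$ are those of the sequence of maps $f_1^m, f_{m+1}^m, f_{2m+1}^m,\dots$, defined in the same way. *)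

theory Defs
  imports "HOL-Analysis.Analysis"
begin

text \<open>
  A sequence of maps \<open>f\<^sub>1, f\<^sub>2, \<dots>\<close> is a function on \<open>nat\<close> whose value at \<open>0\<close> is never used.
  \<open>seq_iter f i j\<close> is \<open>f\<^sub>i\<^sup>j = f\<^bsub>i+j-1\<^esub> \<circ> \<dots> \<circ> f\<^bsub>i+1\<^esub> \<circ> f\<^sub>i\<close>.
\<close>

primrec seq_iter :: "(nat \<Rightarrow> 'a \<Rightarrow> 'a) \<Rightarrow> nat \<Rightarrow> nat \<Rightarrow> 'a \<Rightarrow> 'a" where
  "seq_iter f i 0 = id"
| "seq_iter f i (Suc j) = f (i + j) \<circ> seq_iter f i j"

text \<open>
  The sequence \<open>f\<^sub>1\<^sup>m, f\<^bsub>m+1\<^esub>\<^sup>m, f\<^bsub>2m+1\<^esub>\<^sup>m, \<dots>\<close>, again indexed from 1.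
\<close>

definition seq_power :: "(nat \<Rightarrow> 'a \<Rightarrow> 'a) \<Rightarrow> nat \<Rightarrow> nat \<Rightarrow> 'a \<Rightarrow> 'a" where
  "seq_power f m i = seq_iter f ((i - 1) * m + 1) m"

definition finite_open_cover :: "'a topology \<Rightarrow> 'a set set \<Rightarrow> bool" where
  "finite_open_cover X \<U> \<longleftrightarrow>
     finite \<U> \<and> (\<forall>U\<in>\<U>. openin X U) \<and> topspace X \<subseteq> \<Union>\<U>"

definition string_set :: "'a topology \<Rightarrow> (nat \<Rightarrow> 'a \<Rightarrow> 'a) \<Rightarrow> 'a set list \<Rightarrow> 'a set" where
  "string_set X f us = {x \<in> topspace X. \<forall>j<length us. seq_iter f 1 j x \<in> us ! j}"

text \<open>
  The strings over \<open>\<U>\<close> whose length lies in \<open>[N, N/\<theta> + 1)\<close>. The case \<open>\<theta> = 0\<close>, where \<open>N/\<theta>\<close> means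
  infinity, is separate because division by zero on the reals yields zero.
\<close>

definition admissible_strings :: "'a set set \<Rightarrow> nat \<Rightarrow> real \<Rightarrow> 'a set list set" where
  "admissible_strings \<U> N \<theta> =
     {us \<in> lists \<U>. N \<le> length us \<and> (\<theta> = 0 \<or> real (length us) < real N / \<theta> + 1)}"

definition string_covers ::
  "'a topology \<Rightarrow> (nat \<Rightarrow> 'a \<Rightarrow> 'a) \<Rightarrow> 'a set \<Rightarrow> 'a set set \<Rightarrow> nat \<Rightarrow> real \<Rightarrow> 'a set list set set" where
  "string_covers X f Z \<U> N \<theta> =
     {\<G>. countable \<G> \<and> \<G> \<subseteq> admissible_strings \<U> N \<theta> \<and> Z \<subseteq> (\<Union>us\<in>\<G>. string_set X f us)}"

definition M_theta ::
  "'a topology \<Rightarrow> (nat \<Rightarrow> 'a \<Rightarrow> 'a) \<Rightarrow> 'a set \<Rightarrow> real \<Rightarrow> 'a set set \<Rightarrow> nat \<Rightarrow> real \<Rightarrow> ennreal" where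
  "M_theta X f Z \<alpha> \<U> N \<theta> =
     (INF \<G>\<in>string_covers X f Z \<U> N \<theta>. \<Sum>\<^sub>\<infinity>us\<in>\<G>. ennreal (exp (- \<alpha> * real (length us))))"

definition lower_m ::
  "'a topology \<Rightarrow> (nat \<Rightarrow> 'a \<Rightarrow> 'a) \<Rightarrow> 'a set \<Rightarrow> real \<Rightarrow> 'a set set \<Rightarrow> real \<Rightarrow> ennreal" where
  "lower_m X f Z \<alpha> \<U> \<theta> = liminf (\<lambda>N. M_theta X f Z \<alpha> \<U> N \<theta>)"

definition upper_m ::
  "'a topology \<Rightarrow> (nat \<Rightarrow> 'a \<Rightarrow> 'a) \<Rightarrow> 'a set \<Rightarrow> real \<Rightarrow> 'a set set \<Rightarrow> real \<Rightarrow> ennreal" where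
  "upper_m X f Z \<alpha> \<U> \<theta> = limsup (\<lambda>N. M_theta X f Z \<alpha> \<U> N \<theta>)"

text \<open>
  Entropies take values in \<open>ennreal\<close>, so the infimum over an empty set of exponents is infinity.
\<close>

definition lower_htop_cover ::
  "'a topology \<Rightarrow> (nat \<Rightarrow> 'a \<Rightarrow> 'a) \<Rightarrow> 'a set \<Rightarrow> 'a set set \<Rightarrow> real \<Rightarrow> ennreal" where
  "lower_htop_cover X f Z \<U> \<theta> = (INF \<alpha>\<in>{\<alpha>. 0 \<le> \<alpha> \<and> lower_m X f Z \<alpha> \<U> \<theta> = 0}. ennreal \<alpha>)"

definition upper_htop_cover ::
  "'a topology \<Rightarrow> (nat \<Rightarrow> 'a \<Rightarrow> 'a) \<Rightarrow> 'a set \<Rightarrow> 'a set set \<Rightarrow> real \<Rightarrow> ennreal" where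
  "upper_htop_cover X f Z \<U> \<theta> = (INF \<alpha>\<in>{\<alpha>. 0 \<le> \<alpha> \<and> upper_m X f Z \<alpha> \<U> \<theta> = 0}. ennreal \<alpha>)"

definition lower_htop ::
  "'a topology \<Rightarrow> (nat \<Rightarrow> 'a \<Rightarrow> 'a) \<Rightarrow> 'a set \<Rightarrow> real \<Rightarrow> ennreal" where
  "lower_htop X f Z \<theta> = (SUP \<U>\<in>{\<U>. finite_open_cover X \<U>}. lower_htop_cover X f Z \<U> \<theta>)"

definition upper_htop ::
  "'a topology \<Rightarrow> (nat \<Rightarrow> 'a \<Rightarrow> 'a) \<Rightarrow> 'a set \<Rightarrow> real \<Rightarrow> ennreal" where
  "upper_htop X f Z \<theta> = (SUP \<U>\<in>{\<U>. finite_open_cover X \<U>}. upper_htop_cover X f Z \<U> \<theta>)"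

end

theory Submission
  imports Defs
begin

text \<open>
  Keep every \<open>m\<close>-th letter of a string for \<open>f\<close>: the resulting string of length \<open>\<lceil>n/m\<rceil>\<close> is a string
  for \<open>f\<^sup>m\<close> over the same cover and describes a larger set of points. Since \<open>m \<lceil>n/m\<rceil> \<ge> n\<close>, its weight at
  exponent \<open>m\<alpha>\<close> is at most the old weight at exponent \<open>\<alpha>\<close>, and the length window at \<open>N\<close> is sent
  into the window at \<open>\<lceil>N/m\<rceil>\<close>. So \<open>M(\<lceil>N/m\<rceil>)\<close> for \<open>f\<^sup>m\<close> at \<open>m\<alpha>\<close> is at most \<open>M(N)\<close> for \<open>f\<close> at \<open>\<alpha>\<close>.
\<close>

lemma seq_iter_add: "seq_iter f i (j + k) = seq_iter f (i + j) k \<circ> seq_iter f i j"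
  by (induction k) (simp_all add: o_assoc add.assoc)

text \<open>The map applied after \<open>j\<close> steps of the power starts at index
  \<open>j * m + 1\<close>, exactly where \<open>seq_iter f 1 (j * m)\<close> stops.\<close>

lemma seq_iter_seq_power: "seq_iter (seq_power f m) 1 j = seq_iter f 1 (j * m)"
proof (induction j)
  case (Suc j)
  have "seq_iter f 1 (j * m + m) = seq_iter f (j * m + 1) m \<circ> seq_iter f 1 (j * m)"
    using seq_iter_add[of f 1 "j * m" m] by simp
  with Suc show ?case
    by (simp add: seq_power_def add.commute)
qed simp

definition ceil_div :: "nat \<Rightarrow> nat \<Rightarrow> nat" where
  "ceil_div n m = (n + m - 1) div m"

lemma ceil_div_mult [simp]: "1 \<le> m \<Longrightarrow> ceil_div (m * n) m = n"
  by (cases m) (auto simp: ceil_div_def intro!: div_nat_eqI)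

lemma le_mult_ceil_div:
  assumes "1 \<le> m"
  shows "n \<le> m * ceil_div n m"
proof -
  have "n + m - 1 < m * Suc ((n + m - 1) div m)"
    using assms dividend_less_times_div[of m "n + m - 1"] by simp
  with assms show ?thesis
    unfolding ceil_div_def by simp
qed

lemma mult_less_of_less_ceil_div:
  assumes "j < ceil_div n m"
  shows "j * m < n"
proof -
  have "Suc j \<le> (n + m - 1) div m"
    using assms unfolding ceil_div_def by simp
  then have "Suc j * m \<le> n + m - 1"
    by (cases "m = 0") (auto simp: less_eq_div_iff_mult_less_eq simp del: mult_Suc)
  \<comment> \<open>For \<open>m = 0\<close> the quotient is \<open>0\<close> by convention, and no
    \<open>j\<close> lies below it.\<close>
  moreover have "m \<noteq> 0"
    using assms unfolding ceil_div_def by (intro notI) simp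
  ultimately show ?thesis by simp
qed

lemma ceil_div_mono: "n \<le> n' \<Longrightarrow> ceil_div n m \<le> ceil_div n' m"
  unfolding ceil_div_def by (intro div_le_mono) simp

lemma filterlim_ceil_div:
  assumes "1 \<le> m"
  shows "filterlim (\<lambda>n. ceil_div n m) sequentially sequentially"
  unfolding filterlim_at_top eventually_sequentially
  using ceil_div_mono[of "m * _" _ m] assms by (metis ceil_div_mult)

definition subsample :: "nat \<Rightarrow> 'b list \<Rightarrow> 'b list" where
  "subsample m us = map (\<lambda>j. us ! (j * m)) [0..<ceil_div (length us) m]"

lemma length_subsample [simp]: "length (subsample m us) = ceil_div (length us) m"
  by (simp add: subsample_def)

lemma nth_subsample: "j < ceil_div (length us) m \<Longrightarrow> subsample m us ! j = us ! (j * m)"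
  by (simp add: subsample_def)

text \<open>Time \<open>j\<close> of the power is time \<open>j * m\<close> of \<open>f\<close>, so
  every condition of the shorter string is already one of the conditions of
  \<open>us\<close>.\<close>

lemma string_set_subsample:
  "string_set X f us \<subseteq> string_set X (seq_power f m) (subsample m us)"
  by (auto simp: string_set_def nth_subsample mult_less_of_less_ceil_div
      seq_iter_seq_power[unfolded One_nat_def])

lemma subsample_admissible:
  assumes "us \<in> admissible_strings \<U> N \<theta>" "0 \<le> \<theta>" "1 \<le> m"
  shows "subsample m us \<in> admissible_strings \<U> (ceil_div N m) \<theta>"
proof -
  have us: "us \<in> lists \<U>" "N \<le> length us" "\<theta> = 0 \<or> real (length us) < real N / \<theta> + 1"
    using assms(1) by (auto simp: admissible_strings_def)
  have "subsample m us \<in> lists \<U>"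
    using us(1) unfolding subsample_def by (auto simp: in_lists_conv_set mult_less_of_less_ceil_div)
  moreover have "real (ceil_div (length us) m) < real (ceil_div N m) / \<theta> + 1" if "\<theta> \<noteq> 0"
  proof (cases "ceil_div (length us) m")
    case 0
    then show ?thesis using assms(2) by (simp add: add_nonneg_pos)
  next
    \<comment> \<open>The \<open>+ 1\<close> in the window absorbs the rounding: the last letter
      kept sits at position \<open>k * m\<close>, so \<open>k * m + 1\<close> is at most the old
      length, and the two ones cancel.\<close>
    case (Suc k)
    then have "Suc (k * m) \<le> length us"
      by (intro Suc_leI mult_less_of_less_ceil_div) simp
    then have "real (Suc (k * m)) \<le> real (length us)"
      by (rule of_nat_mono)
    also have "\<dots> < real N / \<theta> + 1"
      using us(3) that by simp
    also have "\<dots> \<le> real (m * ceil_div N m) / \<theta> + 1"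
      using assms by (intro add_right_mono divide_right_mono of_nat_mono le_mult_ceil_div) auto
    finally have "real m * real k < real m * (real (ceil_div N m) / \<theta>)"
      by (simp add: mult.commute)
    then have "real k < real (ceil_div N m) / \<theta>"
      by (rule mult_left_less_imp_less) simp
    then show ?thesis using Suc by simp
  qed
  ultimately show ?thesis
    using us(2) by (auto simp: admissible_strings_def intro: ceil_div_mono)
qed

text \<open>Distinct strings may have the same subsample, so an image can have fewer terms than its
  source. Choosing one preimage of each value turns the left side into a sum over a subset of
  \<open>A\<close>.\<close>

lemma infsum_image_le_ennreal:
  fixes F :: "'b \<Rightarrow> ennreal"
  shows "infsum F (h ` A) \<le> infsum (\<lambda>x. F (h x)) A"
proof -
  define s where "s = inv_into A h"
  have inj: "inj_on s (h ` A)"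
    unfolding s_def by (rule inj_on_inv_into) simp
  have "infsum F (h ` A) = infsum ((\<lambda>x. F (h x)) \<circ> s) (h ` A)"
    by (intro infsum_cong) (simp add: s_def f_inv_into_f)
  also have "\<dots> = infsum (\<lambda>x. F (h x)) (s ` h ` A)"
    by (rule infsum_reindex[OF inj, symmetric])
  also have "\<dots> \<le> infsum (\<lambda>x. F (h x)) A"
    by (intro infsum_mono_neutral nonneg_summable_on_complete)
      (auto simp: s_def inv_into_into)
  finally show ?thesis .
qed

lemma M_theta_seq_power_le:
  assumes "0 \<le> \<theta>" "1 \<le> m" "0 \<le> \<alpha>"
  shows "M_theta X (seq_power f m) Z (real m * \<alpha>) \<U> (ceil_div N m) \<theta> \<le> M_theta X f Z \<alpha> \<U> N \<theta>"
  unfolding M_theta_def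
proof (rule INF_greatest)
  fix \<G> assume \<G>: "\<G> \<in> string_covers X f Z \<U> N \<theta>"
  have "subsample m ` \<G> \<in> string_covers X (seq_power f m) Z \<U> (ceil_div N m) \<theta>"
    using \<G> subsample_admissible[OF _ assms(1,2)] string_set_subsample[of X f _ m]
    unfolding string_covers_def by (simp add: image_subset_iff subset_iff) blast
  then have "(INF \<G>\<in>string_covers X (seq_power f m) Z \<U> (ceil_div N m) \<theta>.
      \<Sum>\<^sub>\<infinity>us\<in>\<G>. ennreal (exp (- (real m * \<alpha>) * real (length us))))
    \<le> (\<Sum>\<^sub>\<infinity>us\<in>subsample m ` \<G>. ennreal (exp (- (real m * \<alpha>) * real (length us))))"
    by (rule INF_lower)
  also have "\<dots> \<le> (\<Sum>\<^sub>\<infinity>us\<in>\<G>. ennreal (exp (- (real m * \<alpha>) * real (length (subsample m us)))))"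
    by (rule infsum_image_le_ennreal)
  also have "\<dots> \<le> (\<Sum>\<^sub>\<infinity>us\<in>\<G>. ennreal (exp (- \<alpha> * real (length us))))"
  proof (intro infsum_mono nonneg_summable_on_complete ennreal_leI)
    fix us :: "'a set list"
    have "real (length us) \<le> real (m * ceil_div (length us) m)"
      by (intro of_nat_mono le_mult_ceil_div assms)
    then have "\<alpha> * real (length us) \<le> \<alpha> * real (m * ceil_div (length us) m)"
      by (intro mult_left_mono assms)
    then show "exp (- (real m * \<alpha>) * real (length (subsample m us))) \<le> exp (- \<alpha> * real (length us))"
      by (simp add: mult_ac)
  qed auto
  finally show "(INF \<G>\<in>string_covers X (seq_power f m) Z \<U> (ceil_div N m) \<theta>.
      \<Sum>\<^sub>\<infinity>us\<in>\<G>. ennreal (exp (- (real m * \<alpha>) * real (length us))))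
    \<le> (\<Sum>\<^sub>\<infinity>us\<in>\<G>. ennreal (exp (- \<alpha> * real (length us))))" .
qed

lemma lower_m_seq_power_le:
  assumes "0 \<le> \<theta>" "1 \<le> m" "0 \<le> \<alpha>"
  shows "lower_m X (seq_power f m) Z (real m * \<alpha>) \<U> \<theta> \<le> lower_m X f Z \<alpha> \<U> \<theta>"
proof -
  let ?M = "\<lambda>N. M_theta X (seq_power f m) Z (real m * \<alpha>) \<U> N \<theta>"
  \<comment> \<open>\<open>ceil_div\<close> repeats values, so this is no strictly increasing
    subsequence. Since it tends to infinity, its image filter is finer than
    \<open>sequentially\<close>, and a finer filter has a larger Liminf.\<close>
  have "liminf ?M \<le> Liminf (filtermap (\<lambda>N. ceil_div N m) sequentially) ?M"
    using filterlim_ceil_div[OF assms(2)] unfolding filterlim_def Liminf_def le_filter_def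
    by (intro SUP_subset_mono) auto
  also have "\<dots> \<le> liminf (\<lambda>N. ?M (ceil_div N m))"
    by (rule Liminf_filtermap_le)
  also have "\<dots> \<le> lower_m X f Z \<alpha> \<U> \<theta>"
    unfolding lower_m_def
    by (intro Liminf_mono always_eventually allI M_theta_seq_power_le assms)
  finally show ?thesis unfolding lower_m_def .
qed

text \<open>A limsup for the power must control every \<open>N\<close>. Each \<open>N\<close> equals
  \<open>ceil_div (m * N) m\<close>, so the values for \<open>f\<close> along the multiples of
  \<open>m\<close> suffice, and a subsequence has the smaller limsup.\<close>

lemma upper_m_seq_power_le:
  assumes "0 \<le> \<theta>" "1 \<le> m" "0 \<le> \<alpha>"
  shows "upper_m X (seq_power f m) Z (real m * \<alpha>) \<U> \<theta> \<le> upper_m X f Z \<alpha> \<U> \<theta>"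
proof -
  have "upper_m X (seq_power f m) Z (real m * \<alpha>) \<U> \<theta>
      \<le> limsup ((\<lambda>N. M_theta X f Z \<alpha> \<U> N \<theta>) \<circ> (\<lambda>N. m * N))"
    unfolding upper_m_def
  proof (intro Limsup_mono always_eventually allI)
    fix N
    show "M_theta X (seq_power f m) Z (real m * \<alpha>) \<U> N \<theta>
        \<le> ((\<lambda>N. M_theta X f Z \<alpha> \<U> N \<theta>) \<circ> (\<lambda>N. m * N)) N"
      using M_theta_seq_power_le[OF assms, of X f Z \<U> "m * N"] assms(2) by simp
  qed
  also have "\<dots> \<le> upper_m X f Z \<alpha> \<U> \<theta>"
    unfolding upper_m_def using assms(2) by (intro limsup_subseq_mono strict_monoI) simp
  finally show ?thesis .
qed

lemma INF_ennreal_scale_le: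
  assumes "1 \<le> m" and "\<And>\<alpha>. \<alpha> \<in> A \<Longrightarrow> real m * \<alpha> \<in> B" and "\<And>\<alpha>. \<alpha> \<in> A \<Longrightarrow> 0 \<le> \<alpha>"
  shows "(INF \<beta>\<in>B. ennreal \<beta>) \<le> of_nat m * (INF \<alpha>\<in>A. ennreal \<alpha>)"
proof -
  let ?I = "INF \<beta>\<in>B. ennreal \<beta>"
  have m: "(of_nat m :: ennreal) \<noteq> 0" "(of_nat m :: ennreal) \<noteq> top"
    using assms(1) by simp_all
  \<comment> \<open>With \<open>m\<close> moved to the left, the claim is a lower bound for each
    single exponent, which also covers an empty \<open>A\<close>. As \<open>m\<close> is nonzero and
    finite, multiplying back is exact.\<close>
  have "?I / of_nat m \<le> (INF \<alpha>\<in>A. ennreal \<alpha>)"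
  proof (rule INF_greatest)
    fix \<alpha> assume "\<alpha> \<in> A"
    then have "?I \<le> ennreal (real m * \<alpha>)"
      by (intro INF_lower assms)
    also have "\<dots> = of_nat m * ennreal \<alpha>"
      unfolding ennreal_of_nat_eq_real_of_nat[of m]
      using assms(3)[OF \<open>\<alpha> \<in> A\<close>] by (intro ennreal_mult) auto
    finally show "?I / of_nat m \<le> ennreal \<alpha>"
      by (rule divide_le_posI_ennreal[rotated]) (use assms(1) in simp)
  qed
  then have "of_nat m * (?I / of_nat m) \<le> of_nat m * (INF \<alpha>\<in>A. ennreal \<alpha>)"
    by (rule mult_left_mono) simp
  then show ?thesis
    using m by (simp add: ennreal_times_divide mult.commute[of "of_nat m" ?I] mult_divide_eq_ennreal)
qed

theorem proposition3p2:
  fixes X :: "'a topology" and f :: "nat \<Rightarrow> 'a \<Rightarrow> 'a"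
    and Z :: "'a set" and \<theta> :: real and m :: nat
  assumes "compact_space X"
    and "\<And>i. 1 \<le> i \<Longrightarrow> continuous_map X X (f i)"
    and "Z \<subseteq> topspace X"
    and "0 \<le> \<theta>" and "\<theta> \<le> 1"
    and "1 \<le> m"
  shows "lower_htop X (seq_power f m) Z \<theta> \<le> of_nat m * lower_htop X f Z \<theta>
    \<and> upper_htop X (seq_power f m) Z \<theta> \<le> of_nat m * upper_htop X f Z \<theta>"
proof -
  \<comment> \<open>The same cover serves both sides: if \<alpha> makes the quantity for
    \<open>f\<close> vanish, then \<open>real m * \<alpha>\<close> does so for the power.\<close>
  have "lower_htop_cover X (seq_power f m) Z \<U> \<theta> \<le> of_nat m * lower_htop_cover X f Z \<U> \<theta>" for \<U>
    unfolding lower_htop_cover_def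
  proof (rule INF_ennreal_scale_le[OF assms(6)])
    fix \<alpha> assume "\<alpha> \<in> {\<alpha>. 0 \<le> \<alpha> \<and> lower_m X f Z \<alpha> \<U> \<theta> = 0}"
    then show "real m * \<alpha> \<in> {\<alpha>. 0 \<le> \<alpha> \<and> lower_m X (seq_power f m) Z \<alpha> \<U> \<theta> = 0}"
      using lower_m_seq_power_le[OF assms(4,6), of \<alpha> X f Z \<U>] by simp
  qed simp
  moreover have "upper_htop_cover X (seq_power f m) Z \<U> \<theta> \<le> of_nat m * upper_htop_cover X f Z \<U> \<theta>" for \<U>
    unfolding upper_htop_cover_def
  proof (rule INF_ennreal_scale_le[OF assms(6)])
    fix \<alpha> assume "\<alpha> \<in> {\<alpha>. 0 \<le> \<alpha> \<and> upper_m X f Z \<alpha> \<U> \<theta> = 0}"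
    then show "real m * \<alpha> \<in> {\<alpha>. 0 \<le> \<alpha> \<and> upper_m X (seq_power f m) Z \<alpha> \<U> \<theta> = 0}"
      using upper_m_seq_power_le[OF assms(4,6), of \<alpha> X f Z \<U>] by simp
  qed simp
  ultimately show ?thesis
    \<comment> \<open>The factor \<open>m\<close> moves inside the supremum over covers, and the two
      suprema are compared term by term.\<close>
    unfolding lower_htop_def upper_htop_def SUP_mult_left_ennreal
    by (intro conjI SUP_mono') auto
qed

end
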